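(* Let $(p_0,p_1)\in(0,\infty)^2$ satisfy $p_0\neq p_1$. Take $r\in(0,\infty]$ and $\kappa\in(0,1)$, and set $p$ by the formula $p^{-1}=(1-\kappa)p_0^{-1}+\kappa p_1^{-1}$. Assume that quasi-normed function spaces $X$, $X_0$, $X_1$ have the property $(X_0,X_1)_{\kappa,r}\subset X$. Then the embedding $$\left(M^{p_0}_{X_0},M^{p_1}_{X_1}\right)_{\kappa,r}\subset M^p_X$$ is valid.
   Context: Function spaces are spaces of functions on $\mathbb{R}^N$, $N\geq 1$. $X$-Morrey spaces: for a quasi-normed function space $X$ and $p\in(0,\infty)$, the local $X$-Morrey space $M^p_X$ is defined as the set of functions $f\in X$ such that $\|f\|_{M^p_X}<\infty$, where $$\|f\|_{M^p_X}:=\sup_{0<R\leq 1}\ \sup_{z\in\mathbb{R}^N}R^{N/p}\,\|f_R\,\chi_{B(z,1)}\|_X .$$ Here $f_\lambda(x):=f(\lambda x)$ for $\lambda>0$, $B(z,1)$ is the open ball in $\mathbb{R}^N$ with center $z$ and radius $1$, and $\chi_E$ is the characteristic function of $E$. Real interpolation: let $X_0,X_1$ be quasi-normed spaces that are subspaces of a common Hausdorff topological vector space. For $f\in X_0+X_1$ and $\lambda>0$ put $$K(f,\lambda;X_0,X_1):=\inf\{\|f_0\|_{X_0}+\lambda\|f_1\|_{X_1}:\ f=f_0+f_1,\ f_0\in X_0,\ f_1\in X_1\}.$$ For $\kappa\in(0,1)$ and $r\in(0,\infty]$, $(X_0,X_1)_{\kappa,r}$ is the set of $f\in X_0+X_1$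 with $\|f\|_{(X_0,X_1)_{\kappa,r}}<\infty$, where $\|f\|_{(X_0,X_1)_{\kappa,r}}:=\left(\int_0^\infty\left(\lambda^{-\kappa}K(f,\lambda;X_0,X_1)\right)^r\frac{d\lambda}{\lambda}\right)^{1/r}$ for $r<\infty$ and $\|f\|_{(X_0,X_1)_{\kappa,\infty}}:=\sup_{\lambda>0}\lambda^{-\kappa}K(f,\lambda;X_0,X_1)$.
   Formalization: With f∈X required globally in the Morrey spaces the claim can fail (f need not lie in X); it is stated with membership required only of all f_Rχ_{B(z,1)}, and, for the literal definition, for those f in the interpolation space that also lie in X. *)

theory Defs
  imports "HOL-Analysis.Analysis"
begin

text \<open>
  A quasi-normed space of functions on \<open>\<real>\<^sup>N\<close> (with \<open>N = CARD('n)\<close>) is represented by its quasi-norm,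
  extended by \<open>\<infinity>\<close> to all functions that do not belong to the space. The values \<open>'k\<close> are meant to be
  real or complex numbers.
\<close>

type_synonym ('n, 'k) gauge = "(real ^ 'n \<Rightarrow> 'k) \<Rightarrow> ennreal"

definition qspace :: "('n::finite, 'k) gauge \<Rightarrow> (real ^ 'n::finite \<Rightarrow> 'k) set" where
  "qspace X = {f. X f < \<infinity>}"

text \<open>
  Functions are not quotiented; instead the quasi-norm has to respect almost everywhere equality.
  Neither completeness nor the lattice property is required.
\<close>

definition quasi_normed_function_space ::
    "('n::finite, 'k::{real_normed_field, euclidean_space}) gauge \<Rightarrow> bool" where
  "quasi_normed_function_space X \<longleftrightarrow>
     (\<forall>f \<in> qspace X. f \<in> borel_measurable lebesgue) \<and>
     (\<forall>f g. (AE x in lebesgue. f x = g x) \<longrightarrow> X f = X g) \<and>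
     (\<forall>f. X f = 0 \<longleftrightarrow> (AE x in lebesgue. f x = 0)) \<and>
     (\<forall>c f. X (\<lambda>x. c * f x) = ennreal (norm c) * X f) \<and>
     (\<exists>C::real. C \<ge> 1 \<and> (\<forall>f g. X (\<lambda>x. f x + g x) \<le> ennreal C * (X f + X g)))"

text \<open>The space of all \<open>f \<in> X\<close> that belong to \<open>S\<close>, with the same quasi-norm.\<close>

definition restrict_gauge :: "(real ^ 'n::finite \<Rightarrow> 'k) set \<Rightarrow> ('n, 'k) gauge \<Rightarrow> ('n, 'k) gauge" where
  "restrict_gauge S X f = (if f \<in> S then X f else \<infinity>)"

definition embedded :: "('n::finite, 'k) gauge \<Rightarrow> ('n, 'k) gauge \<Rightarrow> bool" (infix "\<hookrightarrow>" 50) where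
  "X \<hookrightarrow> Y \<longleftrightarrow>
     qspace X \<subseteq> qspace Y \<and> (\<exists>C::real. C \<ge> 0 \<and> (\<forall>f \<in> qspace X. Y f \<le> ennreal C * X f))"

text \<open>
  The Morrey quasi-norm. It is infinite as soon as one of the functions \<open>f\<^sub>R \<chi>\<^bsub>B(z,1)\<^esub>\<close> fails to lie in
  \<open>X\<close>, so \<open>qspace (local_morrey p X)\<close> consists of the functions that lie in \<open>X\<close> locally, in this
  sense, and have finite Morrey quasi-norm.
\<close>

definition local_morrey ::
    "real \<Rightarrow> ('n::finite, 'k::{real_normed_field, euclidean_space}) gauge \<Rightarrow> ('n, 'k) gauge" where
  "local_morrey p X f =
     (SUP R \<in> {0<..1}. SUP z. ennreal (R powr (real CARD('n) / p)) *
        X (\<lambda>x. f (R *\<^sub>R x) * indicator (ball z 1) x))"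

text \<open>
  The variant whose elements are in addition required to lie in \<open>X\<close> globally. The distinction matters:
  finiteness of \<open>local_morrey p X f\<close> does not force \<open>f \<in> X\<close>, for example if \<open>X\<close> is \<open>L\<^sup>1\<close>.
\<close>

definition global_morrey ::
    "real \<Rightarrow> ('n::finite, 'k::{real_normed_field, euclidean_space}) gauge \<Rightarrow> ('n, 'k) gauge" where
  "global_morrey p X = restrict_gauge (qspace X) (local_morrey p X)"

text \<open>The infimum over the empty set is \<open>\<infinity>\<close>, so the K-functional is infinite outside \<open>X\<^sub>0 + X\<^sub>1\<close>.\<close>

definition K_functional ::
    "('n::finite, 'k::plus) gauge \<Rightarrow> ('n, 'k) gauge \<Rightarrow> (real ^ 'n \<Rightarrow> 'k) \<Rightarrow> real \<Rightarrow> ennreal" where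
  "K_functional X0 X1 f t =
     (INF (f0, f1) \<in> {(f0, f1). f0 \<in> qspace X0 \<and> f1 \<in> qspace X1 \<and> f = (\<lambda>x. f0 x + f1 x)}.
        X0 f0 + ennreal t * X1 f1)"

text \<open>Powers with positive real exponent on \<open>[0,\<infinity>]\<close>.\<close>

definition ennreal_powr :: "ennreal \<Rightarrow> real \<Rightarrow> ennreal" where
  "ennreal_powr a s = (if a = \<infinity> then \<infinity> else ennreal (enn2real a powr s))"

definition real_interpolation ::
    "real \<Rightarrow> ennreal \<Rightarrow> ('n::finite, 'k::plus) gauge \<Rightarrow> ('n, 'k) gauge \<Rightarrow> ('n, 'k) gauge" where
  "real_interpolation \<kappa> r X0 X1 f =
     (if r = \<infinity>
      then SUP t \<in> {0<..}. ennreal (t powr - \<kappa>) * K_functional X0 X1 f t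
      else ennreal_powr
             (\<integral>\<^sup>+ t \<in> {0<..}.
                (ennreal_powr (ennreal (t powr - \<kappa>) * K_functional X0 X1 f t) (enn2real r)
                   * ennreal (1 / t)) \<partial>lborel)
             (1 / enn2real r))"

end

theory Submission
  imports Defs
begin

text \<open>
  For fixed \<open>R\<close> and \<open>z\<close> the map \<open>T f = f\<^sub>R \<chi>\<^bsub>B(z,1)\<^esub>\<close> is linear and maps \<open>M\<^bsup>p\<^sub>i\<^esup>\<close> of \<open>X\<^sub>i\<close> into \<open>X\<^sub>i\<close> with
  norm at most \<open>R\<^bsup>-N/p\<^sub>i\<^esup>\<close>. Interpolating, it maps the interpolation space of the Morrey spaces
  into that of the \<open>X\<^sub>i\<close>, hence into \<open>X\<close>, with norm at most a constant times
  \<open>(R\<^bsup>-N/p\<^sub>0\<^esup>)\<^bsup>1-\<kappa>\<^esup> (R\<^bsup>-N/p\<^sub>1\<^esup>)\<^bsup>\<kappa>\<^esup> = R\<^bsup>-N/p\<^esup>\<close>. This is uniform in \<open>z\<close> and gives the Morrey bound.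
\<close>

lemma ennreal_powr_mono:
  assumes "a \<le> b" "0 \<le> s"
  shows "ennreal_powr a s \<le> ennreal_powr b s"
proof (cases "b = \<infinity>")
  case False
  with assms(1) have "a < \<infinity>" "b < \<infinity>"
    by (auto simp: less_top top_unique)
  then show ?thesis
    using assms by (auto simp: ennreal_powr_def intro!: ennreal_leI powr_mono2 enn2real_mono)
qed (simp add: ennreal_powr_def)

lemma ennreal_powr_cmult:
  assumes "0 < c"
  shows "ennreal_powr (ennreal c * a) s = ennreal (c powr s) * ennreal_powr a s"
  using assms
  by (cases a) (auto simp: ennreal_powr_def ennreal_mult_top powr_mult enn2real_mult
      simp flip: ennreal_mult)

lemma measurable_ennreal_powr [measurable (raw)]:
  assumes [measurable]: "f \<in> borel_measurable M"
  shows "(\<lambda>x. ennreal_powr (f x) s) \<in> borel_measurable M"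
  unfolding ennreal_powr_def by measurable

text \<open>Moves a finite positive factor across an inequality whose sides may be infinite. It
  serves to take a constant out of an infimum and to divide by the Morrey weight.\<close>

lemma ennreal_le_cmult_iff:
  fixes x y :: ennreal
  assumes "0 < c"
  shows "x \<le> ennreal c * y \<longleftrightarrow> ennreal (1 / c) * x \<le> y"
proof -
  have "ennreal c * (ennreal (1 / c) * x) = x"
    using assms by (simp flip: mult.assoc ennreal_mult)
  moreover have "ennreal (1 / c) * (ennreal c * y) = y"
    using assms by (simp flip: mult.assoc ennreal_mult)
  ultimately show ?thesis
    by (metis mult_left_mono zero_le)
qed

lemma K_functional_mono: "s \<le> t \<Longrightarrow> K_functional X0 X1 f s \<le> K_functional X0 X1 f t"
  unfolding K_functional_def
  by (rule INF_superset_mono) (auto intro!: add_left_mono mult_right_mono ennreal_leI)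

text \<open>Superlevel sets of a monotone function are intervals. This is the route to measurability
  of the K-functional in its parameter, since an infimum over a possibly uncountable family of
  decompositions gives none directly.\<close>

lemma borel_measurable_mono_ennreal:
  fixes f :: "real \<Rightarrow> ennreal"
  assumes "mono f"
  shows "f \<in> borel_measurable borel"
proof (rule borel_measurableI_ge)
  fix y
  have "is_interval (f -` {y..})"
    unfolding is_interval_1 using assms by (auto dest: monoD intro: order_trans)
  then have "f -` {y..} \<in> sets borel"
    by (rule real_interval_borel_measurable)
  then show "{x \<in> space borel. y \<le> f x} \<in> sets borel"
    by (simp add: vimage_def)
qed

lemma measurable_K_functional [measurable]: "K_functional X0 X1 f \<in> borel_measurable borel"
  by (intro borel_measurable_mono_ennreal monoI K_functional_mono)

text \<open>By additivity, \<open>T\<close> carries each decomposition \<open>f = g + h\<close> to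
  one of \<open>T f\<close>, at cost at most \<open>a * Y0 g + t * b * Y1 h\<close>. Factoring out
  \<open>a\<close> turns the parameter \<open>t\<close> into \<open>b / a * t\<close>.\<close>

lemma K_functional_bounded_operator:
  fixes X0 X1 Y0 Y1 :: "('n::finite, 'k::plus) gauge"
  assumes "0 < a" "0 < b" "0 \<le> t"
    and T_add: "\<And>g h. T (\<lambda>x. g x + h x) = (\<lambda>x. T g x + T h x)"
    and T0: "\<And>g. X0 (T g) \<le> ennreal a * Y0 g"
    and T1: "\<And>g. X1 (T g) \<le> ennreal b * Y1 g"
  shows "K_functional X0 X1 (T f) t \<le> ennreal a * K_functional Y0 Y1 f (b / a * t)"
proof -
  have "K_functional X0 X1 (T f) t \<le> ennreal a * (Y0 g + ennreal (b / a * t) * Y1 h)"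
    if "g \<in> qspace Y0" "h \<in> qspace Y1" and f: "f = (\<lambda>x. g x + h x)" for g h
  proof -
    \<comment> \<open>Finiteness is preserved by \<open>T\<close>, so \<open>(T g, T h)\<close> is
      an admissible pair in the infimum.\<close>
    have "T g \<in> qspace X0" "T h \<in> qspace X1"
      using that T0[of g] T1[of h] unfolding qspace_def
      by (auto simp: ennreal_mult_less_top intro: le_less_trans)
    then have "K_functional X0 X1 (T f) t \<le> X0 (T g) + ennreal t * X1 (T h)"
      unfolding K_functional_def by (intro INF_lower2[of "(T g, T h)"]) (auto simp: f T_add)
    also have "\<dots> \<le> ennreal a * Y0 g + ennreal t * (ennreal b * Y1 h)"
      by (intro add_mono mult_left_mono T0 T1) auto
    also have "\<dots> = ennreal a * (Y0 g + ennreal (b / a * t) * Y1 h)"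
    proof -
      have "ennreal t * ennreal b = ennreal a * ennreal (b / a * t)"
        using assms(1-3) by (simp add: mult.commute flip: ennreal_mult)
      then show ?thesis
        by (simp add: distrib_left flip: mult.assoc)
    qed
    finally show ?thesis .
  qed
  \<comment> \<open>Once \<open>a\<close> is moved to the left, it suffices to bound each term of
    the infimum; if \<open>f\<close> has no decomposition, the infimum is infinite.\<close>
  then show ?thesis
    using \<open>0 < a\<close> unfolding ennreal_le_cmult_iff[OF \<open>0 < a\<close>] K_functional_def[of Y0]
    by (intro INF_greatest) auto
qed

text \<open>The dilation by \<open>b / a\<close> in the bound for the K-functional changes neither a
  supremum over all positive \<open>t\<close> nor an integral against dt/t; the weight
  \<open>t powr - \<kappa>\<close> turns it into a constant factor.\<close>

lemma real_interpolation_bounded_operator: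
  fixes X0 X1 Y0 Y1 :: "('n::finite, 'k::plus) gauge"
  assumes "0 < a" "0 < b" "0 < r"
    and T_add: "\<And>g h. T (\<lambda>x. g x + h x) = (\<lambda>x. T g x + T h x)"
    and T0: "\<And>g. X0 (T g) \<le> ennreal a * Y0 g"
    and T1: "\<And>g. X1 (T g) \<le> ennreal b * Y1 g"
  shows "real_interpolation \<kappa> r X0 X1 (T f)
    \<le> ennreal (a powr (1 - \<kappa>) * b powr \<kappa>) * real_interpolation \<kappa> r Y0 Y1 f"
proof -
  define c where "c = a powr (1 - \<kappa>) * b powr \<kappa>"
  define d where "d = b / a"
  define G where "G t = ennreal (t powr - \<kappa>) * K_functional X0 X1 (T f) t" for t
  define H where "H t = ennreal (t powr - \<kappa>) * K_functional Y0 Y1 f t" for t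
  have pos: "0 < c" "0 < d"
    using assms by (auto simp: c_def d_def)
  have [measurable]: "H \<in> borel_measurable borel"
    unfolding H_def by measurable
  have GH: "G t \<le> ennreal c * H (d * t)" if "0 < t" for t
  proof -
    \<comment> \<open>Since \<open>t powr - \<kappa> = d powr \<kappa> * (d * t) powr -
      \<kappa>\<close>, the constant is \<open>a * (b / a) powr \<kappa> = c\<close>.\<close>
    have "t powr - \<kappa> * a = c * (d * t) powr - \<kappa>"
      using assms(1,2) that
      by (simp add: c_def d_def powr_mult powr_divide powr_minus powr_diff field_simps)
    then have "ennreal (t powr - \<kappa>) * ennreal a = ennreal c * ennreal ((d * t) powr - \<kappa>)"
      using pos \<open>0 < a\<close> by (simp flip: ennreal_mult)
    moreover have "G t \<le> ennreal (t powr - \<kappa>) * (ennreal a * K_functional Y0 Y1 f (d * t))"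
      unfolding G_def d_def using assms that
      by (intro mult_left_mono K_functional_bounded_operator) auto
    ultimately show ?thesis
      by (simp add: H_def flip: mult.assoc)
  qed
  show ?thesis
  proof (cases "r = \<infinity>")
    case True
    have "G t \<le> ennreal c * (SUP t \<in> {0<..}. H t)" if "0 < t" for t
      using pos that by (intro order_trans[OF GH[OF that]] mult_left_mono SUP_upper) auto
    then show ?thesis
      using True by (auto simp: real_interpolation_def G_def H_def c_def intro!: SUP_least)
  next
    case False
    define q where "q = enn2real r"
    \<comment> \<open>As \<open>enn2real\<close> sends \<infinity> to 0, positivity of
      \<open>q\<close> also rests on \<open>r\<close> being finite in this case.\<close>
    have q: "0 < q"
      using False \<open>0 < r\<close> by (simp add: q_def enn2real_positive_iff less_top)
    \<comment> \<open>With the indicator built in, \<open>\<Phi>\<close> lives on the whole line,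
      where the linear change of variables is available; as \<open>d > 0\<close>, the dilation
      preserves the half-line.\<close>
    define \<Phi> where
      "\<Phi> t = ennreal_powr (H t) q * ennreal (1 / t) * indicator {0<..} t" for t
    have [measurable]: "\<Phi> \<in> borel_measurable borel"
      unfolding \<Phi>_def by measurable
    have "ennreal_powr (G t) q * ennreal (1 / t) * indicator {0<..} t
        \<le> ennreal (c powr q) * (ennreal d * \<Phi> (d * t))" for t
    proof (cases "0 < t")
      case True
      have "ennreal_powr (G t) q \<le> ennreal (c powr q) * ennreal_powr (H (d * t)) q"
        using ennreal_powr_mono[OF GH[OF True], of q] q by (simp add: ennreal_powr_cmult pos)
      then have "ennreal_powr (G t) q * ennreal (1 / t)
          \<le> ennreal (c powr q) * ennreal_powr (H (d * t)) q * ennreal (1 / t)"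
        by (rule mult_right_mono) simp
      also have "\<dots> = ennreal (c powr q) * (ennreal d * \<Phi> (d * t))"
      proof -
        \<comment> \<open>Dilation invariance of dt/t: the factor \<open>d\<close> is the Jacobian
          of \<open>t \<mapsto> d * t\<close> and disappears in the substitution.\<close>
        have "ennreal (1 / t) = ennreal d * ennreal (1 / (d * t))"
          using pos True by (simp flip: ennreal_mult)
        then show ?thesis
          using pos True by (simp add: \<Phi>_def mult.left_commute mult.assoc)
      qed
      finally show ?thesis
        using True by simp
    qed simp
    then have "(\<integral>\<^sup>+ t \<in> {0<..}. (ennreal_powr (G t) q * ennreal (1 / t)) \<partial>lborel)
        \<le> (\<integral>\<^sup>+ t. ennreal (c powr q) * (ennreal d * \<Phi> (d * t)) \<partial>lborel)"
      by (intro nn_integral_mono)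
    also have "\<dots> = ennreal (c powr q) * (\<integral>\<^sup>+ t. \<Phi> t \<partial>lborel)"
      using nn_integral_real_affine[of \<Phi> d 0] pos by (simp add: nn_integral_cmult)
    finally have "ennreal_powr (\<integral>\<^sup>+ t \<in> {0<..}. (ennreal_powr (G t) q * ennreal (1 / t)) \<partial>lborel) (1 / q)
        \<le> ennreal_powr (ennreal (c powr q) * (\<integral>\<^sup>+ t. \<Phi> t \<partial>lborel)) (1 / q)"
      using q by (intro ennreal_powr_mono) auto
    also have "\<dots> = ennreal c * ennreal_powr (\<integral>\<^sup>+ t. \<Phi> t \<partial>lborel) (1 / q)"
      using pos q by (simp add: ennreal_powr_cmult powr_powr)
    finally show ?thesis
      using False by (simp add: real_interpolation_def G_def H_def \<Phi>_def c_def q_def)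
  qed
qed

text \<open>The identity is an operator with both bounds equal to 1.\<close>

lemma real_interpolation_mono:
  fixes X0 X1 Y0 Y1 :: "('n::finite, 'k::plus) gauge"
  assumes "0 < r" "\<And>g. X0 g \<le> Y0 g" "\<And>g. X1 g \<le> Y1 g"
  shows "real_interpolation \<kappa> r X0 X1 f \<le> real_interpolation \<kappa> r Y0 Y1 f"
  using real_interpolation_bounded_operator[of 1 1 r "\<lambda>g. g" X0 Y0 X1 Y1 \<kappa> f] assms by simp

lemma gauge_localization_le_local_morrey:
  fixes X :: "('n::finite, 'k::{real_normed_field, euclidean_space}) gauge"
  assumes "0 < R" "R \<le> 1"
  shows "X (\<lambda>x. f (R *\<^sub>R x) * indicator (ball z 1) x)
    \<le> ennreal (R powr - (real CARD('n) / p)) * local_morrey p X f"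
proof -
  have "ennreal (R powr (real CARD('n) / p)) * X (\<lambda>x. f (R *\<^sub>R x) * indicator (ball z 1) x)
      \<le> local_morrey p X f"
    unfolding local_morrey_def using assms by (intro SUP_upper2[of R] SUP_upper) auto
  then show ?thesis
    using assms by (subst ennreal_le_cmult_iff) (simp_all add: powr_minus divide_simps)
qed

lemma local_morrey_le_global_morrey: "local_morrey p X f \<le> global_morrey p X f"
  by (simp add: global_morrey_def restrict_gauge_def)

text \<open>The interpolated operator norm R^(-N/p) cancels the weight R^(N/p) in the Morrey
  quasi-norm of \<open>X\<close>, so the constant of the assumed embedding carries over
  unchanged.\<close>

lemma real_interpolation_local_morrey_embedded:
  fixes X X0 X1 :: "('n::finite, 'k::{real_normed_field, euclidean_space}) gauge"
  assumes "0 < r"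
    and p: "1 / p = (1 - \<kappa>) / p0 + \<kappa> / p1"
    and "real_interpolation \<kappa> r X0 X1 \<hookrightarrow> X"
  shows "real_interpolation \<kappa> r (local_morrey p0 X0) (local_morrey p1 X1) \<hookrightarrow> local_morrey p X"
proof -
  let ?I = "real_interpolation \<kappa> r (local_morrey p0 X0) (local_morrey p1 X1)"
  let ?N = "real CARD('n)"
  obtain C where "0 \<le> C"
    and C: "\<And>f. f \<in> qspace (real_interpolation \<kappa> r X0 X1)
      \<Longrightarrow> X f \<le> ennreal C * real_interpolation \<kappa> r X0 X1 f"
    using assms(3) unfolding embedded_def by blast
  have bound: "local_morrey p X f \<le> ennreal C * ?I f" if f: "?I f < \<infinity>" for f
    unfolding local_morrey_def[of p X]
  proof (intro SUP_least)
    fix R :: real and z :: "real ^ 'n"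
    assume "R \<in> {0<..1}"
    then have R: "0 < R" "R \<le> 1"
      by auto
    define T where "T g = (\<lambda>x. g (R *\<^sub>R x) * indicator (ball z 1) x)" for g :: "real ^ 'n \<Rightarrow> 'k"
    have "?N / p = ?N / p0 * (1 - \<kappa>) + ?N / p1 * \<kappa>"
      using arg_cong[OF p, of "\<lambda>u. ?N * u"] by (simp add: distrib_left)
    then have exponent: "(R powr - (?N / p0)) powr (1 - \<kappa>) * (R powr - (?N / p1)) powr \<kappa>
        = R powr - (?N / p)"
      unfolding powr_powr powr_add[symmetric] by (intro arg_cong[where f = "(powr) R"]) linarith
    have T: "real_interpolation \<kappa> r X0 X1 (T f) \<le> ennreal (R powr - (?N / p)) * ?I f"
      unfolding exponent[symmetric]
    proof (rule real_interpolation_bounded_operator)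
      show "X0 (T g) \<le> ennreal (R powr - (?N / p0)) * local_morrey p0 X0 g" for g
        unfolding T_def by (rule gauge_localization_le_local_morrey[OF R])
      show "X1 (T g) \<le> ennreal (R powr - (?N / p1)) * local_morrey p1 X1 g" for g
        unfolding T_def by (rule gauge_localization_le_local_morrey[OF R])
      show "T (\<lambda>x. g x + h x) = (\<lambda>x. T g x + T h x)" for g h
        by (simp add: T_def distrib_right)
    qed (use R \<open>0 < r\<close> in auto)
    \<comment> \<open>The bound with \<open>C\<close> is available only on the interpolation space,
      so \<open>T f\<close> must first be shown to belong to it.\<close>
    also have "\<dots> < \<infinity>"
      using f by (simp add: ennreal_mult_less_top)
    finally have "X (T f) \<le> ennreal C * real_interpolation \<kappa> r X0 X1 (T f)"
      by (intro C) (simp add: qspace_def)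
    also have "\<dots> \<le> ennreal C * (ennreal (R powr - (?N / p)) * ?I f)"
      by (intro mult_left_mono T) simp
    finally have "X (T f) \<le> ennreal (R powr - (?N / p)) * (ennreal C * ?I f)"
      by (simp only: mult_ac)
    then have "ennreal (R powr (?N / p)) * X (T f) \<le> ennreal C * ?I f"
      using R by (subst (asm) ennreal_le_cmult_iff) (simp_all add: powr_minus divide_simps)
    then show "ennreal (R powr (?N / p)) * X (\<lambda>x. f (R *\<^sub>R x) * indicator (ball z 1) x)
        \<le> ennreal C * ?I f"
      by (simp add: T_def)
  qed
  have "local_morrey p X f < \<infinity>" if f: "?I f < \<infinity>" for f
    using bound[OF f] f by (auto simp: ennreal_mult_less_top intro: le_less_trans)
  then show ?thesis
    using bound \<open>0 \<le> C\<close> unfolding embedded_def qspace_def by auto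
qed

text \<open>The Morrey quasi-norm controls only localizations, so the argument does not place an
  interpolated \<open>f\<close> in \<open>X\<close> itself. Hence the second conjunct, whose target
  requires membership in \<open>X\<close>, restricts the source to \<open>qspace X\<close>.\<close>

theorem proposition2p10:
  fixes p0 p1 p \<kappa> :: real and r :: ennreal
    and X X0 X1 :: "('n::finite, 'k::{real_normed_field, euclidean_space}) gauge"
  assumes "0 < p0" and "0 < p1" and "p0 \<noteq> p1"
    and "0 < r" and "0 < \<kappa>" and "\<kappa> < 1"
    and "1 / p = (1 - \<kappa>) / p0 + \<kappa> / p1"
    and "quasi_normed_function_space X"
    and "quasi_normed_function_space X0"
    and "quasi_normed_function_space X1"
    and "real_interpolation \<kappa> r X0 X1 \<hookrightarrow> X"
  shows "real_interpolation \<kappa> r (local_morrey p0 X0) (local_morrey p1 X1) \<hookrightarrow> local_morrey p X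
    \<and> restrict_gauge (qspace X)
         (real_interpolation \<kappa> r (global_morrey p0 X0) (global_morrey p1 X1)) \<hookrightarrow> global_morrey p X"
proof
  show local: "real_interpolation \<kappa> r (local_morrey p0 X0) (local_morrey p1 X1) \<hookrightarrow> local_morrey p X"
    using assms(4,7,11) by (rule real_interpolation_local_morrey_embedded)
  let ?L = "real_interpolation \<kappa> r (local_morrey p0 X0) (local_morrey p1 X1)"
  let ?G = "real_interpolation \<kappa> r (global_morrey p0 X0) (global_morrey p1 X1)"
  \<comment> \<open>The global gauges differ from the local ones only by being infinite outside
    \<open>X0\<close> and \<open>X1\<close>, so passing to them can only increase the interpolation
    gauge.\<close>
  have LG: "?L f \<le> ?G f" for f
    using \<open>0 < r\<close> by (intro real_interpolation_mono local_morrey_le_global_morrey)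
  obtain C where "0 \<le> C"
    and C: "\<And>f. f \<in> qspace ?L \<Longrightarrow> local_morrey p X f < \<infinity> \<and> local_morrey p X f \<le> ennreal C * ?L f"
    using local unfolding embedded_def qspace_def by blast
  \<comment> \<open>On \<open>qspace X\<close> the local and global Morrey gauges of
    \<open>X\<close> agree, so the first conjunct together with \<open>LG\<close> suffices.\<close>
  have "global_morrey p X f < \<infinity> \<and> global_morrey p X f \<le> ennreal C * ?G f"
    if "f \<in> qspace X" "?G f < \<infinity>" for f
  proof -
    have "f \<in> qspace ?L"
      using LG[of f] that by (simp add: qspace_def)
    with C[of f] have "local_morrey p X f < \<infinity>" "local_morrey p X f \<le> ennreal C * ?G f"
      using mult_left_mono[OF LG[of f], of "ennreal C"] by (auto intro: order_trans)
    with that show ?thesis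
      by (simp add: global_morrey_def restrict_gauge_def)
  qed
  then show "restrict_gauge (qspace X) ?G \<hookrightarrow> global_morrey p X"
    using \<open>0 \<le> C\<close> unfolding embedded_def
    by (auto simp: qspace_def[of "restrict_gauge _ _"] qspace_def[of "global_morrey _ _"]
        restrict_gauge_def split: if_splits)
qed

end
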